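(* Let $s\ge 0$, let $p>1$, and let $\rho:\mathbb{R}^N\to\mathbb{R}$, $\mathbb{R}^N=\mathbb{R}^{N_1}\times\mathbb{R}^{N_2}$, be a radial continuous function for which there exist $\alpha\ge 0$ and $C>0$ such that $$\rho(\mathbf{x})\ge C\left(1+\|\mathbf{x}\|^{2(s+1)}\right)^{\frac{\alpha}{2(s+1)}}\quad\text{for all }\mathbf{x}\in\mathbb{R}^N .$$ If $$N_s<2+\frac{2(2+\alpha)}{p+1}\left(p+\sqrt{p^2+p}\right),$$ then the equation $$\Delta_s u=\rho(\mathbf{x})u^{-p},\qquad u>0\quad\text{in }\mathbb{R}^N$$ has no bounded stable solution.
   Context: $N=N_1+N_2$ with $N_1,N_2\ge 1$; points are $\mathbf{x}=(x,y)\in\mathbb{R}^{N_1}\times\mathbb{R}^{N_2}$, and $|x|,|y|$ are Euclidean norms. The Grushin operator is $\Delta_s=\Delta_x+|x|^{2s}\Delta_y$, where $\Delta_x,\Delta_y$ are the Laplacians in $x$ and $y$. The Grushin norm is $\|\mathbf{x}\|=(|x|^{2(s+1)}+|y|^2)^{\frac{1}{2(s+1)}}$; "radial" means depending only on $\|\mathbf{x}\|$. The homogeneous dimension is $N_s=N_1+(1+s)N_2$. A solution is a positive function $u\in C^2(\mathbb{R}^N)$ satisfying the equation. It is stable if the pair $(u,u)$ is a stable solution of the system $\Delta_s u=\rho v^{-p}$, $\Delta_s v=\rho u^{-p}$, that is, if there are positive smooth functions $\varphi,\chi$ on $\mathbb{R}^N$ such that $$-\Delta_s\varphi=p\,\rho(\mathbf{x})\,u^{-p-1}\chi,\qquad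 -\Delta_s\chi=p\,\rho(\mathbf{x})\,u^{-p-1}\varphi\quad\text{in }\mathbb{R}^N.$$ *)

theory Defs
  imports "HOL-Analysis.Analysis"
begin

text \<open>
  Points of \<open>R^(N1) \<times> R^(N2)\<close> are elements of \<^typ>\<open>(real^'n) \<times> (real^'m)\<close>,
  with \<open>N1 = CARD('n)\<close> and \<open>N2 = CARD('m)\<close>.
\<close>

definition partial_deriv :: "'a::euclidean_space \<Rightarrow> ('a \<Rightarrow> real) \<Rightarrow> 'a \<Rightarrow> real" where
  "partial_deriv b f z = frechet_derivative f (at z) b"

text \<open>
  The class \<open>C^k\<close> on the whole space. The differentiability requirement makes the
  Frechet derivatives in \<^const>\<open>partial_deriv\<close> meaningful; together with the continuity of
  the partial derivatives this is the usual class.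
\<close>

fun Ck :: "nat \<Rightarrow> ('a::euclidean_space \<Rightarrow> real) \<Rightarrow> bool" where
  "Ck 0 f \<longleftrightarrow> continuous_on UNIV f"
| "Ck (Suc k) f \<longleftrightarrow> f differentiable_on UNIV \<and> (\<forall>b\<in>Basis. Ck k (partial_deriv b f))"

definition smooth :: "('a::euclidean_space \<Rightarrow> real) \<Rightarrow> bool" where
  "smooth f \<longleftrightarrow> (\<forall>k. Ck k f)"

definition laplacian_x :: "((real^'n) \<times> (real^'m) \<Rightarrow> real) \<Rightarrow> (real^'n) \<times> (real^'m) \<Rightarrow> real" where
  "laplacian_x f z = (\<Sum>i\<in>UNIV. partial_deriv (axis i 1, 0) (partial_deriv (axis i 1, 0) f) z)"

definition laplacian_y :: "((real^'n) \<times> (real^'m) \<Rightarrow> real) \<Rightarrow> (real^'n) \<times> (real^'m) \<Rightarrow> real" where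
  "laplacian_y f z = (\<Sum>j\<in>UNIV. partial_deriv (0, axis j 1) (partial_deriv (0, axis j 1) f) z)"

text \<open>
  The weight \<open>|x|^(2s)\<close>. The case distinction is needed because \<open>0 powr 0 = 0\<close>, whereas the
  weight is identically 1 for \<open>s = 0\<close>, where the operator is the Laplacian.
\<close>

definition grushin_weight :: "real \<Rightarrow> real^'n \<Rightarrow> real" where
  "grushin_weight s x = (if s = 0 then 1 else norm x powr (2 * s))"

definition grushin :: "real \<Rightarrow> ((real^'n) \<times> (real^'m) \<Rightarrow> real) \<Rightarrow> (real^'n) \<times> (real^'m) \<Rightarrow> real" where
  "grushin s f z = laplacian_x f z + grushin_weight s (fst z) * laplacian_y f z"

definition grushin_norm :: "real \<Rightarrow> (real^'n) \<times> (real^'m) \<Rightarrow> real" where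
  "grushin_norm s z =
     (norm (fst z) powr (2 * (s + 1)) + (norm (snd z))\<^sup>2) powr (1 / (2 * (s + 1)))"

definition grushin_radial :: "real \<Rightarrow> ((real^'n) \<times> (real^'m) \<Rightarrow> real) \<Rightarrow> bool" where
  "grushin_radial s f \<longleftrightarrow> (\<exists>g. \<forall>z. f z = g (grushin_norm s z))"

definition is_solution ::
  "real \<Rightarrow> real \<Rightarrow> ((real^'n) \<times> (real^'m) \<Rightarrow> real) \<Rightarrow> ((real^'n) \<times> (real^'m) \<Rightarrow> real) \<Rightarrow> bool" where
  "is_solution s p \<rho> u \<longleftrightarrow>
     Ck 2 u \<and> (\<forall>z. u z > 0) \<and> (\<forall>z. grushin s u z = \<rho> z * u z powr (-p))"

text \<open>
  Stability of the pair \<open>(u, u)\<close> for the system \<open>\<Delta>\<^sub>s u = \<rho> v^(-p)\<close>, \<open>\<Delta>\<^sub>s v = \<rho> u^(-p)\<close>: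
  existence of a positive solution of the linearised system.
\<close>

definition stable_solution ::
  "real \<Rightarrow> real \<Rightarrow> ((real^'n) \<times> (real^'m) \<Rightarrow> real) \<Rightarrow> ((real^'n) \<times> (real^'m) \<Rightarrow> real) \<Rightarrow> bool" where
  "stable_solution s p \<rho> u \<longleftrightarrow>
     (\<exists>\<phi> \<psi>. smooth \<phi> \<and> smooth \<psi> \<and> (\<forall>z. \<phi> z > 0) \<and> (\<forall>z. \<psi> z > 0) \<and>
       (\<forall>z. - grushin s \<phi> z = p * \<rho> z * u z powr (-p - 1) * \<psi> z) \<and>
       (\<forall>z. - grushin s \<psi> z = p * \<rho> z * u z powr (-p - 1) * \<phi> z))"

definition homogeneous_dim :: "nat \<Rightarrow> nat \<Rightarrow> real \<Rightarrow> real" where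
  "homogeneous_dim N1 N2 s = real N1 + (1 + s) * real N2"

end

theory Submission
  imports Defs
begin

text \<open>
  The sum \<open>w = \<phi> + \<psi>\<close> satisfies \<open>-\<Delta>\<^sub>s w = p V w\<close> with \<open>V = \<rho> u^(-p-1)\<close>, while \<open>\<Delta>\<^sub>s u = V u\<close>. For a
  cutoff \<open>\<eta>\<close>, the field \<open>\<eta>\<^sup>2 u^(-2a) (\<nabla>w/w + \<mu> \<nabla>u/u)\<close> has divergence with integral zero, and pointwise
  this divergence is at most \<open>-(p - \<mu>) \<eta>\<^sup>2 u^(-2a) V + K u^(-2a) |\<nabla>\<^sub>s \<eta>|\<^sup>2\<close> as soon as
  \<open>a\<^sup>2 < \<mu> (1 + 2a)\<close>; some \<open>\<mu> < p\<close> does this exactly when \<open>a < p + sqrt (p\<^sup>2 + p)\<close>. Take for \<open>\<eta>\<close> a power of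
  a cutoff at scale \<open>|x| ~ r\<close>, \<open>|y| ~ r^(1+s)\<close>. On the support of \<open>\<nabla>\<eta>\<close> one has \<open>\<rho> \<ge> C r^\<alpha>\<close>, and the gradient
  term is absorbed up to a remainder \<open>O(r^(-2-2a(2+\<alpha>)/(p+1)))\<close> on a box of volume \<open>O(r^N\<^sub>s)\<close>. The energy
  in the unit ball is bounded below since \<open>u\<close> is bounded, which is impossible as \<open>r\<close> tends to infinity.
\<close>

section \<open>Integration of a directional derivative with compact support\<close>

text \<open>Averaging \<open>F'\<close> over the segment from \<open>z\<close> to
  \<open>z + b\<close> gives \<open>F (z + b) - F z\<close>, whose integral over z vanishes by
  translation invariance. By Fubini the same double integral equals the integral of
  \<open>F'\<close>. Only the derivative along \<open>b\<close> is involved, so the lemma applies to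
  fields that carry the factor |x|^(2s), which may be differentiable in no other direction.\<close>

lemma has_integral_directional_derivative_0:
  fixes F F' :: "'a::euclidean_space \<Rightarrow> real"
  assumes F: "continuous_on UNIV F" and F': "continuous_on UNIV F'"
    and deriv: "\<And>z. ((\<lambda>t. F (z + t *\<^sub>R b)) has_real_derivative F' z) (at 0)"
    and supp: "\<And>z. norm z > r \<Longrightarrow> F z = 0" "\<And>z. norm z > r \<Longrightarrow> F' z = 0"
  shows "(F' has_integral 0) UNIV"
proof -
  \<comment> \<open>The half-width \<open>\<bar>r\<bar> + norm b\<close> leaves room for every shift
    by \<open>t *\<^sub>R b\<close> with t in [0,1]: a point outside this box still has norm above
    \<open>r\<close> after the shift. One fixed box thus serves all t, as Fubini requires.\<close>
  define q where "q = (\<Sum>i\<in>Basis. (\<bar>r\<bar> + norm b) *\<^sub>R i :: 'a)"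
  have big: "norm z > \<bar>r\<bar> + norm b" if "z \<notin> cbox (-q) q" for z
  proof -
    obtain i where "i \<in> Basis" "\<bar>z \<bullet> i\<bar> > \<bar>r\<bar> + norm b"
      using \<open>z \<notin> _\<close> by (force simp: mem_box q_def)
    then show ?thesis using Basis_le_norm[of i z] by linarith
  qed
  have big': "norm (z + t *\<^sub>R b) > r" if "z \<notin> cbox (-q) q" "t \<in> {0..1}" for z t
  proof -
    have "norm z \<le> norm (z + t *\<^sub>R b) + norm (t *\<^sub>R b)" by (metis add_diff_cancel norm_triangle_ineq4)
    moreover have "norm (t *\<^sub>R b) \<le> norm b"
      using that by (simp add: mult_left_le_one_le)
    ultimately show ?thesis using big[OF that(1)] by linarith
  qed
  have line: "((\<lambda>t. F (z + t *\<^sub>R b)) has_real_derivative F' (z + t *\<^sub>R b)) (at t)" for z t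
  proof -
    have "((\<lambda>x. F ((z + t *\<^sub>R b) + x *\<^sub>R b)) has_real_derivative F' (z + t *\<^sub>R b)) (at 0)"
      by (rule deriv)
    then have "((\<lambda>x. F (z + (x + t) *\<^sub>R b)) has_real_derivative F' (z + t *\<^sub>R b)) (at 0)"
      by (simp add: algebra_simps)
    then show ?thesis using DERIV_shift[of "\<lambda>t. F (z + t *\<^sub>R b)" "F' (z + t *\<^sub>R b)" 0 t] by simp
  qed
  have shift: "((\<lambda>z. G (z + t *\<^sub>R b)) has_integral integral UNIV G) (cbox (-q) q)"
    if G: "continuous_on UNIV G" "\<And>z. norm z > r \<Longrightarrow> G z = 0" and t: "t \<in> {0..1}"
    for G :: "'a \<Rightarrow> real" and t
  proof -
    have "(\<lambda>z. G (z + t *\<^sub>R b)) integrable_on cbox (-q) q"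
      by (intro integrable_continuous continuous_intros continuous_on_compose2[OF G(1)]) auto
    then obtain I where I: "((\<lambda>z. G (z + t *\<^sub>R b)) has_integral I) (cbox (-q) q)" by blast
    have "(G has_integral I) (cbox (-q + t *\<^sub>R b) (q + t *\<^sub>R b))"
      using I has_integral_shift_cbox_iff[of G "t *\<^sub>R b" I "-q" q] by (simp add: o_def add.commute)
    then have "(G has_integral I) UNIV"
    proof (rule has_integral_on_superset)
      fix z assume "z \<notin> cbox (-q + t *\<^sub>R b) (q + t *\<^sub>R b)"
      then have "z - t *\<^sub>R b \<notin> cbox (-q) q"
        by (auto simp: mem_box algebra_simps)
      from big'[OF this t] show "G z = 0" using G(2) by simp
    qed auto
    then show ?thesis using I by (simp add: integral_unique)
  qed
  have "integral {0..1} (\<lambda>t. F' (z + t *\<^sub>R b)) = F (z + b) - F z" for z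
    using fundamental_theorem_of_calculus[of 0 1 "\<lambda>t. F (z + t *\<^sub>R b)" "\<lambda>t. F' (z + t *\<^sub>R b)"] line
    by (intro integral_unique)
       (auto simp: has_real_derivative_iff_has_vector_derivative
         intro: has_vector_derivative_at_within)
  then have "integral (cbox (-q) q) (\<lambda>z. integral (cbox 0 1) (\<lambda>t. F' (z + t *\<^sub>R b)))
      = integral (cbox (-q) q) (\<lambda>z. F (z + b) - F z)"
    by simp
  also have "\<dots> = 0"
    using has_integral_diff[OF shift[OF F supp(1), of 1] shift[OF F supp(1), of 0]]
    by (simp add: integral_unique)
  also have "integral (cbox (-q) q) (\<lambda>z. integral (cbox 0 1) (\<lambda>t. F' (z + t *\<^sub>R b)))
      = integral (cbox 0 1) (\<lambda>t. integral (cbox (-q) q) (\<lambda>z. F' (z + t *\<^sub>R b)))"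
    by (rule integral_swap_continuous)
       (auto intro!: continuous_intros continuous_on_compose2[OF F'] simp: case_prod_unfold)
  also have "\<dots> = integral (cbox 0 1) (\<lambda>t::real. integral UNIV F')"
    by (intro integral_cong integral_unique shift[OF F' supp(2)]) auto
  finally have 0: "integral UNIV F' = 0" by simp
  have "(F' has_integral integral UNIV F') (cbox (-q) q)"
    using shift[OF F' supp(2), of 0] by simp
  then have "(F' has_integral integral UNIV F') UNIV"
    by (rule has_integral_on_superset) (use big'[of _ 0] supp in auto)
  with 0 show ?thesis by simp
qed

section \<open>A one-dimensional cutoff profile\<close>

text \<open>Only the kink at 0 needs an argument: there the difference quotient is at most
  \<open>\<bar>h\<bar> ^ (n + 1)\<close>, which tends to 0 because the exponent is at least
  2.\<close>

lemma DERIV_max_0_power: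
  "((\<lambda>x::real. max 0 x ^ (n + 2)) has_real_derivative real (n + 2) * max 0 x ^ (n + 1)) (at x)"
proof -
  consider "x < 0" | "x > 0" | "x = 0" by linarith
  then show ?thesis
  proof cases
    case 1
    have "((\<lambda>x::real. 0) has_real_derivative real (n + 2) * max 0 x ^ (n + 1)) (at x)"
      using 1 by (simp add: max_def)
    then show ?thesis
      by (rule has_field_derivative_transform_within_open[where S = "{..<0}"]) (use 1 in \<open>auto simp: max_def\<close>)
  next
    case 2
    have "((\<lambda>x::real. x ^ (n + 2)) has_real_derivative real (n + 2) * max 0 x ^ (n + 1)) (at x)"
      using 2 DERIV_pow[of "n + 2" x] by (simp add: max_def)
    then show ?thesis
      by (rule has_field_derivative_transform_within_open[where S = "{0<..}"]) (use 2 in \<open>auto simp: max_def\<close>)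
  next
    case 3
    have "((\<lambda>h::real. max 0 h ^ (n + 2) / h) \<longlongrightarrow> 0) (at 0)"
    proof (rule Lim_null_comparison)
      show "\<forall>\<^sub>F h in at 0. norm (max 0 h ^ (n + 2) / h) \<le> \<bar>h\<bar> ^ (n + 1)"
      proof (rule always_eventually, rule allI)
        fix h :: real
        show "norm (max 0 h ^ (n + 2) / h) \<le> \<bar>h\<bar> ^ (n + 1)"
          by (cases "h \<le> 0") (simp_all add: max_absorb1 max_absorb2 mult_nonpos_nonneg)
      qed
      show "((\<lambda>h::real. \<bar>h\<bar> ^ (n + 1)) \<longlongrightarrow> 0) (at 0)"
        by (auto intro!: tendsto_eq_intros)
    qed
    then show ?thesis using 3 by (simp add: DERIV_def)
  qed
qed

text \<open>The profile is 1 up to t = 1 and 0 from t = 2 on. It has a kink at t = 2, which the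
  powers \<open>n + 2\<close> used below smooth to class C^1; the energy argument differentiates the
  cutoff only once.\<close>

definition bump :: "real \<Rightarrow> real" where
  "bump t = max 0 (1 - (max 0 (t - 1))\<^sup>2)"

definition bump_power_deriv :: "nat \<Rightarrow> real \<Rightarrow> real" where
  "bump_power_deriv n t = - (2 * real (n + 2) * bump t ^ (n + 1) * max 0 (t - 1))"

lemma bump_bounds: "0 \<le> bump t" "bump t \<le> 1"
  by (auto simp: bump_def)

lemma bump_eq_1: "t \<le> 1 \<Longrightarrow> bump t = 1"
  by (simp add: bump_def)

lemma bump_eq_0: 
  assumes "t \<ge> 2" shows "bump t = 0"
proof -
  have "1 \<le> (t - 1)\<^sup>2" using assms by (intro one_le_power) auto
  then show ?thesis using assms by (simp add: bump_def)
qed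

lemma continuous_on_bump [continuous_intros]:
  "continuous_on S f \<Longrightarrow> continuous_on S (\<lambda>x. bump (f x))"
  unfolding bump_def by (intro continuous_intros)

lemma continuous_on_bump_power_deriv [continuous_intros]:
  "continuous_on S f \<Longrightarrow> continuous_on S (\<lambda>x. bump_power_deriv n (f x))"
  unfolding bump_power_deriv_def by (intro continuous_intros)

lemma DERIV_bump_power:
  "((\<lambda>t. bump t ^ (n + 2)) has_real_derivative bump_power_deriv n t) (at t)"
proof -
  have 1: "((\<lambda>t::real. (max 0 (t - 1))\<^sup>2) has_real_derivative 2 * max 0 (t - 1)) (at t)"
  proof -
    have "((\<lambda>t::real. t - 1) has_real_derivative 1) (at t)"
      by (auto intro!: derivative_eq_intros)
    from DERIV_chain2[where f = "\<lambda>x. max 0 x ^ (0 + 2)" and g = "\<lambda>t. t - 1", OF DERIV_max_0_power this]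
    show ?thesis by (simp add: power2_eq_square)
  qed
  have 2: "((\<lambda>t::real. 1 - (max 0 (t - 1))\<^sup>2) has_real_derivative - (2 * max 0 (t - 1))) (at t)"
    using DERIV_diff[OF DERIV_const[of 1] 1] by simp
  show ?thesis
    using DERIV_chain2[where f = "\<lambda>x. max 0 x ^ (n + 2)" and g = "\<lambda>t. 1 - (max 0 (t - 1))\<^sup>2", OF DERIV_max_0_power 2]
    by (simp add: bump_def bump_power_deriv_def algebra_simps)
qed

text \<open>The factor \<open>max 0 (t - 1)\<close> is at most 1 wherever \<open>bump\<close> does
  not vanish. Differentiation costs a single power of \<open>bump\<close>; the remaining power
  \<open>n + 1\<close> is what later makes the absorption possible.\<close>

lemma bump_power_deriv_bound:
  "\<bar>bump_power_deriv n t\<bar> \<le> 2 * real (n + 2) * bump t ^ (n + 1)"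
proof (cases "t \<ge> 2")
  case True
  then show ?thesis by (simp add: bump_power_deriv_def bump_eq_0)
next
  case False
  then have "\<bar>max 0 (t - 1)\<bar> \<le> 1" by auto
  from mult_left_mono[OF this, of "2 * real (n + 2) * bump t ^ (n + 1)"] show ?thesis
    by (simp add: bump_power_deriv_def bump_bounds abs_mult)
qed

lemma bump_power_deriv_eq_0: "t \<le> 1 \<or> t \<ge> 2 \<Longrightarrow> bump_power_deriv n t = 0"
  by (auto simp: bump_power_deriv_def bump_eq_0)

section \<open>The pointwise quadratic inequality and the choice of exponents\<close>

text \<open>With D = \<mu>(1 + 2a) - a^2 > 0 the terms quadratic in X, Y are -(X + aY)^2 - D Y^2,
  and the cross term splits as 2N(X + aY) + 2N(\<mu> - a)Y. Completing the square in each half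
  leaves a multiple of N^2. In the application N is a derivative of the cutoff, while X and Y are
  the cutoff times logarithmic derivatives of w and u.\<close>

lemma quadratic_form_bound:
  fixes N X Y a \<mu> :: real
  assumes "a\<^sup>2 < \<mu> * (1 + 2 * a)"
  shows "2 * N * (X + \<mu> * Y) - 2 * a * X * Y - \<mu> * (1 + 2 * a) * Y\<^sup>2 - X\<^sup>2
    \<le> (1 + (\<mu> - a)\<^sup>2 / (\<mu> * (1 + 2 * a) - a\<^sup>2)) * N\<^sup>2"
proof -
  define D where "D = \<mu> * (1 + 2 * a) - a\<^sup>2"
  have "D > 0" using assms by (simp add: D_def)
  have "D * (2 * N * (\<mu> - a) * Y) \<le> D * ((\<mu> - a)\<^sup>2 / D * N\<^sup>2 + D * Y\<^sup>2)"
  proof -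
    have "D * ((\<mu> - a)\<^sup>2 / D * N\<^sup>2 + D * Y\<^sup>2) - D * (2 * N * (\<mu> - a) * Y) = ((\<mu> - a) * N - D * Y)\<^sup>2"
      using \<open>D > 0\<close> by (simp add: distrib_left) (simp add: algebra_simps power2_eq_square)
    then show ?thesis using zero_le_power2[of "(\<mu> - a) * N - D * Y"] by linarith
  qed
  then have 1: "2 * N * (\<mu> - a) * Y \<le> (\<mu> - a)\<^sup>2 / D * N\<^sup>2 + D * Y\<^sup>2"
    using \<open>D > 0\<close> by (simp only: mult_le_cancel_left_pos)
  have 2: "2 * N * (X + a * Y) \<le> N\<^sup>2 + (X + a * Y)\<^sup>2"
    using zero_le_power2[of "N - (X + a * Y)"] by (simp add: power2_eq_square algebra_simps)
  have "2 * N * (X + \<mu> * Y) - 2 * a * X * Y - \<mu> * (1 + 2 * a) * Y\<^sup>2 - X\<^sup>2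
     = 2 * N * (X + a * Y) + 2 * N * (\<mu> - a) * Y - (X + a * Y)\<^sup>2 - D * Y\<^sup>2"
    by (simp add: D_def power2_eq_square algebra_simps)
  also have "\<dots> \<le> N\<^sup>2 + (\<mu> - a)\<^sup>2 / D * N\<^sup>2" using 1 2 by linarith
  finally show ?thesis by (simp add: D_def algebra_simps)
qed

text \<open>The condition a^2 < p(1 + 2a) means
  \<open>\<bar>a - p\<bar> < sqrt (p\<^sup>2 + p)\<close>. Since it is strict, it survives replacing
  p by a slightly smaller \<mu>, and the gap p - \<mu> pays for the absorption later.\<close>

lemma exponent_exists:
  fixes p \<alpha> Q :: real
  assumes p: "p > 1" and \<alpha>: "\<alpha> \<ge> 0"
    and Q: "Q < 2 + 2 * (2 + \<alpha>) / (p + 1) * (p + sqrt (p\<^sup>2 + p))"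
  obtains a \<mu> where "a > 0" "\<mu> < p" "a\<^sup>2 < \<mu> * (1 + 2 * a)" "Q < 2 + 2 * a * (2 + \<alpha>) / (p + 1)"
proof -
  define A where "A = p + sqrt (p\<^sup>2 + p)"
  \<comment> \<open>Solving the last required inequality for \<open>a\<close> gives
    \<open>B < a\<close>, and the hypothesis on \<open>Q\<close> amounts to
    \<open>B < A\<close>.\<close>
  define B where "B = (Q - 2) * (p + 1) / (2 * (2 + \<alpha>))"
  have "A > 0" using p by (simp add: A_def add_pos_nonneg)
  have "Q - 2 < 2 * (2 + \<alpha>) * A / (p + 1)" using Q by (simp add: A_def)
  then have "(Q - 2) * (p + 1) < 2 * (2 + \<alpha>) * A" using p by (simp add: pos_less_divide_eq)
  then have "B < A" unfolding B_def using \<alpha> by (simp add: pos_divide_less_eq mult_ac)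
  obtain a where a: "max 0 B < a" "a < A" using dense[of "max 0 B" A] \<open>A > 0\<close> \<open>B < A\<close> by auto
  have "\<bar>a - p\<bar> < sqrt (p\<^sup>2 + p)"
  proof -
    \<comment> \<open>This gives the lower half of the absolute value bound: a > 0 > p - sqrt(p^2 +
      p).\<close>
    have "p < sqrt (p\<^sup>2 + p)" using p by (intro real_less_rsqrt) auto
    then show ?thesis using a by (auto simp: A_def abs_less_iff)
  qed
  then have "\<bar>a - p\<bar>\<^sup>2 < (sqrt (p\<^sup>2 + p))\<^sup>2" by (intro power_strict_mono) auto
  also have "(sqrt (p\<^sup>2 + p))\<^sup>2 = p\<^sup>2 + p" using p by simp
  finally have "a\<^sup>2 < p * (1 + 2 * a)" by (simp add: power2_eq_square algebra_simps)
  then have "a\<^sup>2 / (1 + 2 * a) < p" using a by (simp add: pos_divide_less_eq)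
  then obtain \<mu> where \<mu>: "a\<^sup>2 / (1 + 2 * a) < \<mu>" "\<mu> < p" using dense by blast
  show thesis
  proof
    show "a > 0" "\<mu> < p" using a \<mu> by auto
    show "a\<^sup>2 < \<mu> * (1 + 2 * a)" using \<mu> a by (simp add: pos_divide_less_eq)
    have "B < a" using a by simp
    then have "(Q - 2) * (p + 1) < 2 * a * (2 + \<alpha>)" unfolding B_def using \<alpha> by (simp add: pos_divide_less_eq mult_ac)
    then have "Q - 2 < 2 * a * (2 + \<alpha>) / (p + 1)" using p by (simp add: pos_less_divide_eq)
    then show "Q < 2 + 2 * a * (2 + \<alpha>) / (p + 1)" by simp
  qed
qed

section \<open>The Grushin operator as a single sum over coordinate directions\<close>

text \<open>For a basis vector \<open>b\<close>, \<open>snd b = 0\<close> singles out the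
  x-directions. The operator becomes one sum over \<open>Basis\<close>, so x- and y-directions share
  the integration by parts.\<close>

definition grushin_coeff :: "real \<Rightarrow> (real^'n) \<times> (real^'m) \<Rightarrow> (real^'n) \<times> (real^'m) \<Rightarrow> real" where
  "grushin_coeff s b z = (if snd b = 0 then 1 else grushin_weight s (fst z))"

lemma grushin_weight_nonneg: "grushin_weight s x \<ge> 0"
  by (simp add: grushin_weight_def)

lemma grushin_coeff_nonneg: "grushin_coeff s b z \<ge> 0"
  by (simp add: grushin_coeff_def grushin_weight_nonneg)

lemma continuous_on_grushin_coeff:
  assumes "s \<ge> 0"
  shows "continuous_on UNIV (grushin_coeff s b)"
proof -
  have "continuous_on UNIV (\<lambda>z::(real^'n) \<times> (real^'m). norm (fst z) powr (2 * s))" if "s > 0"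
    using that by (intro continuous_on_powr' continuous_intros) auto
  then show ?thesis
    using assms unfolding grushin_coeff_def grushin_weight_def
    by (cases "snd b = 0"; cases "s = 0") auto
qed

text \<open>
  The degenerate coefficient is constant along the direction of its own derivative, so the operator is
  in divergence form even though \<open>|x|^(2s)\<close> need not be differentiable.
\<close>

lemma grushin_coeff_shift:
  assumes "b \<in> Basis"
  shows "grushin_coeff s b (z + t *\<^sub>R b) = grushin_coeff s b z"
  using assms by (auto simp: grushin_coeff_def Basis_prod_def)

lemma sum_Basis_cart: "(\<Sum>b\<in>(Basis :: (real^'n) set). f b) = (\<Sum>i\<in>UNIV. f (axis i 1))"
proof -
  have "(Basis :: (real^'n) set) = (\<lambda>i. axis i 1) ` UNIV"
    by (auto simp: Basis_vec_def)
  moreover have "inj (\<lambda>i::'n. axis i (1::real))" by (auto simp: inj_def axis_eq_axis)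
  ultimately show ?thesis using sum.reindex[of "\<lambda>i::'n. axis i (1::real)" UNIV f] by (simp only: o_def)
qed

lemma sum_Basis_prod:
  "(\<Sum>b\<in>(Basis :: ('a::euclidean_space \<times> 'b::euclidean_space) set). f b)
    = (\<Sum>i\<in>Basis. f (i, 0)) + (\<Sum>i\<in>Basis. f (0, i))"
proof -
  have "inj_on (\<lambda>u. (u::'a, 0::'b)) Basis" "inj_on (\<lambda>u. (0::'a, u::'b)) Basis"
    by (auto intro!: inj_onI)
  then show ?thesis
    unfolding Basis_prod_def
    by (subst sum.union_disjoint) (auto simp: sum.reindex)
qed

lemma grushin_eq_sum:
  "grushin s f z = (\<Sum>b\<in>Basis. grushin_coeff s b z * partial_deriv b (partial_deriv b f) z)"
  unfolding sum_Basis_prod sum_Basis_cart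
  by (simp add: grushin_def grushin_coeff_def laplacian_x_def laplacian_y_def sum_distrib_left
      axis_eq_0_iff)

lemma has_real_derivative_partial_deriv:
  assumes "f differentiable_on UNIV"
  shows "((\<lambda>t. f (z + t *\<^sub>R b)) has_real_derivative partial_deriv b f z) (at 0)"
proof -
  have "(f has_derivative frechet_derivative f (at z)) (at z)"
    using assms by (simp add: differentiable_on_def flip: frechet_derivative_works)
  then have f: "(f has_derivative frechet_derivative f (at z)) (at (z + 0 *\<^sub>R b))" by simp
  have "((\<lambda>t. z + t *\<^sub>R b) has_derivative (\<lambda>t. t *\<^sub>R b)) (at 0)"
    by (auto intro!: derivative_eq_intros)
  from has_derivative_compose[OF this f]
  have "((\<lambda>t. f (z + t *\<^sub>R b)) has_derivative (\<lambda>t. frechet_derivative f (at z) (t *\<^sub>R b))) (at 0)" .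
  moreover have "frechet_derivative f (at z) (t *\<^sub>R b) = partial_deriv b f z * t" for t
    using f linear_frechet_derivative[of f "at z"] assms
    by (simp add: partial_deriv_def differentiable_on_def linear_scale)
  ultimately show ?thesis by (simp add: has_field_derivative_def)
qed

lemma Ck_2_D:
  assumes "Ck 2 f" "b \<in> Basis"
  shows "f differentiable_on UNIV" "partial_deriv b f differentiable_on UNIV"
    "continuous_on UNIV f" "continuous_on UNIV (partial_deriv b f)"
    "continuous_on UNIV (partial_deriv b (partial_deriv b f))"
  using assms by (auto simp: numeral_2_eq_2 intro: differentiable_imp_continuous_on)

section \<open>The anisotropic cutoff and its gradient\<close>

text \<open>The scales r and r^(1+s) are those of the dilations under which the Grushin operator is
  homogeneous of degree 2. Squared norms avoid the singularity of the norm at x = 0 or y =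
  0.\<close>

definition box_bump :: "real \<Rightarrow> real \<Rightarrow> (real^'n) \<times> (real^'m) \<Rightarrow> real" where
  "box_bump s r z = bump (fst z \<bullet> fst z / r\<^sup>2) * bump (snd z \<bullet> snd z / (r powr (1 + s))\<^sup>2)"

definition box_bump_power_deriv ::
  "nat \<Rightarrow> real \<Rightarrow> real \<Rightarrow> (real^'n) \<times> (real^'m) \<Rightarrow> (real^'n) \<times> (real^'m) \<Rightarrow> real" where
  "box_bump_power_deriv n s r b z =
     bump_power_deriv n (fst z \<bullet> fst z / r\<^sup>2) * (2 * (fst z \<bullet> fst b) / r\<^sup>2)
       * bump (snd z \<bullet> snd z / (r powr (1 + s))\<^sup>2) ^ (n + 2)
     + bump (fst z \<bullet> fst z / r\<^sup>2) ^ (n + 2)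
       * bump_power_deriv n (snd z \<bullet> snd z / (r powr (1 + s))\<^sup>2)
       * (2 * (snd z \<bullet> snd b) / (r powr (1 + s))\<^sup>2)"

lemma box_bump_bounds: "0 \<le> box_bump s r z" "box_bump s r z \<le> 1"
  by (auto simp: box_bump_def bump_bounds mult_le_one)

lemma continuous_on_box_bump [continuous_intros]:
  assumes "r > 0"
  shows "continuous_on S (box_bump s r)"
  unfolding box_bump_def using assms by (intro continuous_intros) auto

lemma continuous_on_box_bump_power_deriv [continuous_intros]:
  assumes "r > 0"
  shows "continuous_on S (box_bump_power_deriv n s r b)"
  unfolding box_bump_power_deriv_def using assms by (intro continuous_intros) auto

lemma DERIV_inner_line:
  fixes x b :: "'a::real_inner"
  shows "((\<lambda>t. (x + t *\<^sub>R b) \<bullet> (x + t *\<^sub>R b) / c) has_real_derivative 2 * (x \<bullet> b) / c) (at 0)"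
proof -
  have "(\<lambda>t. (x + t *\<^sub>R b) \<bullet> (x + t *\<^sub>R b) / c)
      = (\<lambda>t. (x \<bullet> x + 2 * t * (x \<bullet> b) + t\<^sup>2 * (b \<bullet> b)) / c)"
    by (simp add: inner_simps inner_commute power2_eq_square algebra_simps)
  moreover have "(\<dots> has_real_derivative 2 * (x \<bullet> b) / c) (at 0)"
    by (auto intro!: derivative_eq_intros DERIV_cdivide)
  ultimately show ?thesis by simp
qed

lemma DERIV_box_bump_power:
  "((\<lambda>t. box_bump s r (z + t *\<^sub>R b) ^ (n + 2)) has_real_derivative box_bump_power_deriv n s r b z) (at 0)"
proof -
  have 1: "((\<lambda>t. bump ((x + t *\<^sub>R c) \<bullet> (x + t *\<^sub>R c) / d) ^ (n + 2)) has_real_derivative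
      bump_power_deriv n (x \<bullet> x / d) * (2 * (x \<bullet> c) / d)) (at 0)" for x c :: "'c::real_inner" and d
    using DERIV_chain2[where f = "\<lambda>x. bump x ^ (n + 2)" and g = "\<lambda>t. (x + t *\<^sub>R c) \<bullet> (x + t *\<^sub>R c) / d",
        OF DERIV_bump_power DERIV_inner_line] by simp
  show ?thesis
    using DERIV_mult[OF 1[of "fst z" "fst b" "r\<^sup>2"] 1[of "snd z" "snd b" "(r powr (1 + s))\<^sup>2"]]
    by (simp add: box_bump_def box_bump_power_deriv_def power_mult_distrib algebra_simps)
qed

text \<open>The gradient of the cutoff lives outside the inner box, where the Grushin norm is at
  least r; this is what makes the growth of \<rho> available.\<close>

lemma box_bump_power_deriv_neq_0D:
  assumes "box_bump_power_deriv n s r b z \<noteq> 0" "r > 0"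
  shows "r\<^sup>2 \<le> fst z \<bullet> fst z \<or> (r powr (1 + s))\<^sup>2 \<le> snd z \<bullet> snd z"
proof (rule ccontr)
  assume "\<not> ?thesis"
  then have "fst z \<bullet> fst z / r\<^sup>2 \<le> 1" "snd z \<bullet> snd z / (r powr (1 + s))\<^sup>2 \<le> 1"
    using assms(2) by (auto simp: divide_simps)
  then show False using assms(1) by (simp add: box_bump_power_deriv_def bump_power_deriv_eq_0)
qed

lemma box_bump_eq_0:
  assumes "r > 0" "2 * r\<^sup>2 \<le> fst z \<bullet> fst z \<or> 2 * (r powr (1 + s))\<^sup>2 \<le> snd z \<bullet> snd z"
  shows "box_bump s r z = 0"
proof -
  have "2 \<le> fst z \<bullet> fst z / r\<^sup>2 \<or> 2 \<le> snd z \<bullet> snd z / (r powr (1 + s))\<^sup>2"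
    using assms by (auto simp: pos_le_divide_eq)
  then show ?thesis by (auto simp: box_bump_def bump_eq_0)
qed

lemma box_bump_power_deriv_eq_0:
  assumes "r > 0" "2 * r\<^sup>2 \<le> fst z \<bullet> fst z \<or> 2 * (r powr (1 + s))\<^sup>2 \<le> snd z \<bullet> snd z"
  shows "box_bump_power_deriv n s r b z = 0"
proof -
  have "2 \<le> fst z \<bullet> fst z / r\<^sup>2 \<or> 2 \<le> snd z \<bullet> snd z / (r powr (1 + s))\<^sup>2"
    using assms by (auto simp: pos_le_divide_eq)
  then show ?thesis by (auto simp: box_bump_power_deriv_def bump_eq_0 bump_power_deriv_eq_0)
qed

lemma box_bump_eq_1:
  assumes "r \<ge> 1" "s \<ge> 0" "norm z \<le> 1"
  shows "box_bump s r z = 1"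
proof -
  have "fst z \<bullet> fst z \<le> 1" "snd z \<bullet> snd z \<le> 1"
    using assms norm_fst_le[of "fst z" "snd z"] norm_snd_le[of "snd z" "fst z"]
    by (auto simp: dot_square_norm power_le_one)
  moreover have "r\<^sup>2 \<ge> 1" "(r powr (1 + s))\<^sup>2 \<ge> 1"
    using assms by (auto simp: one_le_power ge_one_powr_ge_zero)
  ultimately have "fst z \<bullet> fst z / r\<^sup>2 \<le> 1" "snd z \<bullet> snd z / (r powr (1 + s))\<^sup>2 \<le> 1"
    by (auto simp: divide_le_eq)
  then show ?thesis by (simp add: box_bump_def bump_eq_1)
qed

lemma powr_one_plus_sq: "(r powr (1 + s))\<^sup>2 = r powr (2 * (s + 1))" for r s :: real
  using powr_add[of r "1 + s" "1 + s"] by (simp add: power2_eq_square algebra_simps)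

lemma grushin_weight_le:
  assumes "s \<ge> 0" "r > 0" "x \<bullet> x \<le> 2 * r\<^sup>2"
  shows "grushin_weight s x \<le> 2 powr s * r powr (2 * s)"
proof (cases "s = 0")
  case True
  then show ?thesis using assms by (simp add: grushin_weight_def)
next
  case False
  have sq: "t powr (2 * s) = (t\<^sup>2) powr s" if "t \<ge> 0" for t :: real
    using that by (simp add: powr_powr[symmetric])
  have "(norm x)\<^sup>2 powr s \<le> (2 * r\<^sup>2) powr s"
    using assms by (intro powr_mono2) (auto simp: dot_square_norm)
  also have "\<dots> = 2 powr s * r powr (2 * s)"
    using assms by (simp add: powr_mult sq)
  finally show ?thesis using False by (simp add: grushin_weight_def sq)
qed

lemma inner_Basis_sq_le: "b \<in> Basis \<Longrightarrow> (x \<bullet> b)\<^sup>2 \<le> x \<bullet> x"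
  using Basis_le_norm[of b x] power_mono[of "\<bar>x \<bullet> b\<bar>" "norm x" 2] by (simp add: dot_square_norm)

text \<open>Shared by both kinds of direction: d is r or r^(1+s), \<theta> the derivative of the
  powered profile, t a coordinate of the point, and h the power of the cutoff in the other
  variable.\<close>

lemma scaled_square_le:
  fixes \<theta> t B c h d :: real
  assumes "\<bar>\<theta>\<bar> \<le> c * B" "t\<^sup>2 \<le> 2 * d\<^sup>2" "d > 0"
  shows "(\<theta> * (2 * t / d\<^sup>2) * h)\<^sup>2 \<le> 8 * c\<^sup>2 / d\<^sup>2 * (B * h)\<^sup>2"
proof -
  have "\<theta>\<^sup>2 \<le> (c * B)\<^sup>2" using assms(1) by (metis abs_ge_zero power_mono power2_abs)
  then have 1: "\<theta>\<^sup>2 * t\<^sup>2 \<le> (c * B)\<^sup>2 * (2 * d\<^sup>2)" using assms(2) by (intro mult_mono) auto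
  have "(\<theta> * (2 * t / d\<^sup>2) * h)\<^sup>2 = \<theta>\<^sup>2 * t\<^sup>2 * (4 * h\<^sup>2 / (d\<^sup>2 * d\<^sup>2))"
    by (simp add: power_mult_distrib power_divide power2_eq_square)
  also have "\<dots> \<le> (c * B)\<^sup>2 * (2 * d\<^sup>2) * (4 * h\<^sup>2 / (d\<^sup>2 * d\<^sup>2))"
    using 1 by (intro mult_right_mono) auto
  also have "\<dots> = 8 * c\<^sup>2 / d\<^sup>2 * (B * h)\<^sup>2"
    using assms(3) by (simp add: power_mult_distrib divide_simps)
  finally show ?thesis .
qed

text \<open>An x-derivative is of size 1/r. A y-derivative is of size r^(-1-s), but on the support
  the weight is at most 2^s r^(2s), so both contribute order r^(-2) to the squared Grushin
  gradient.\<close>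

lemma box_bump_gradient_bound:
  fixes z :: "(real^'n) \<times> (real^'m)"
  assumes s: "s \<ge> 0" and r: "r > 0" and b: "b \<in> Basis"
  shows "grushin_coeff s b z * (box_bump_power_deriv n s r b z)\<^sup>2
    \<le> 8 * (2 * real (n + 2))\<^sup>2 * 2 powr s / r\<^sup>2 * box_bump s r z ^ (2 * (n + 1))"
proof (cases "2 * r\<^sup>2 \<le> fst z \<bullet> fst z \<or> 2 * (r powr (1 + s))\<^sup>2 \<le> snd z \<bullet> snd z")
  case True
  then show ?thesis using r by (simp add: box_bump_power_deriv_eq_0 box_bump_bounds)
next
  case False
  define \<xi> where "\<xi> = bump (fst z \<bullet> fst z / r\<^sup>2)"
  define \<zeta> where "\<zeta> = bump (snd z \<bullet> snd z / (r powr (1 + s))\<^sup>2)"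
  define c where "c = 2 * real (n + 2)"
  have \<xi>: "0 \<le> \<xi>" "\<xi> \<le> 1" and \<zeta>: "0 \<le> \<zeta>" "\<zeta> \<le> 1" by (auto simp: \<xi>_def \<zeta>_def bump_bounds)
  have bb: "box_bump s r z ^ (2 * (n + 1)) = (\<xi> ^ (n + 1) * \<zeta> ^ (n + 1))\<^sup>2"
    by (simp only: box_bump_def \<xi>_def \<zeta>_def power_mult_distrib flip: power_mult)
       (simp add: mult.commute)
  have s2: "2 powr s \<ge> 1" using s by (simp add: ge_one_powr_ge_zero)
  from b consider (x) b1 where "b = (b1, 0)" "b1 \<in> Basis" | (y) b2 where "b = (0, b2)" "b2 \<in> Basis"
    by (auto simp: Basis_prod_def)
  then show ?thesis
  proof cases
    case x
    have "grushin_coeff s b z * (box_bump_power_deriv n s r b z)\<^sup>2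
        = (bump_power_deriv n (fst z \<bullet> fst z / r\<^sup>2) * (2 * (fst z \<bullet> b1) / r\<^sup>2) * \<zeta> ^ (n + 2))\<^sup>2"
      using x by (simp add: grushin_coeff_def box_bump_power_deriv_def \<zeta>_def)
    also have "\<dots> \<le> 8 * c\<^sup>2 / r\<^sup>2 * (\<xi> ^ (n + 1) * \<zeta> ^ (n + 2))\<^sup>2"
      using False r inner_Basis_sq_le[OF x(2), of "fst z"]
      by (intro scaled_square_le) (auto simp: c_def \<xi>_def simp del: power_Suc intro!: order_trans[OF bump_power_deriv_bound])
    also have "\<dots> \<le> 8 * c\<^sup>2 / r\<^sup>2 * (\<xi> ^ (n + 1) * \<zeta> ^ (n + 1))\<^sup>2"
      using \<xi> \<zeta> by (intro mult_left_mono power_mono power_decreasing) auto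
    \<comment> \<open>The factor \<open>2 powr s\<close> is inserted so that both kinds of direction
      have the same constant.\<close>
    also have "\<dots> \<le> 8 * c\<^sup>2 * 2 powr s / r\<^sup>2 * (\<xi> ^ (n + 1) * \<zeta> ^ (n + 1))\<^sup>2"
      using s2 r by (intro mult_right_mono divide_right_mono) (auto simp: c_def)
    finally show ?thesis by (simp only: bb c_def)
  next
    case y
    define S where "S = r powr (1 + s)"
    have "S > 0" using r by (simp add: S_def)
    have "b2 \<noteq> 0" using y by auto
    have S2: "S\<^sup>2 = r\<^sup>2 * r powr (2 * s)"
    proof -
      have "S\<^sup>2 = r powr (2 + 2 * s)"
        by (simp add: S_def powr_one_plus_sq algebra_simps)
      then show ?thesis using r by (simp add: powr_add)
    qed
    have "(box_bump_power_deriv n s r b z)\<^sup>2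
        = (bump_power_deriv n (snd z \<bullet> snd z / S\<^sup>2) * (2 * (snd z \<bullet> b2) / S\<^sup>2) * \<xi> ^ (n + 2))\<^sup>2"
      using y by (simp add: box_bump_power_deriv_def \<xi>_def S_def mult_ac)
    also have "\<dots> \<le> 8 * c\<^sup>2 / S\<^sup>2 * (\<zeta> ^ (n + 1) * \<xi> ^ (n + 2))\<^sup>2"
      using False \<open>S > 0\<close> inner_Basis_sq_le[OF y(2), of "snd z"]
      by (intro scaled_square_le) (auto simp: c_def \<zeta>_def S_def simp del: power_Suc intro!: order_trans[OF bump_power_deriv_bound])
    also have "\<dots> \<le> 8 * c\<^sup>2 / S\<^sup>2 * (\<zeta> ^ (n + 1) * \<xi> ^ (n + 1))\<^sup>2"
      using \<xi> \<zeta> by (intro mult_left_mono power_mono power_decreasing) auto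
    finally have 1: "(box_bump_power_deriv n s r b z)\<^sup>2
        \<le> 8 * c\<^sup>2 / S\<^sup>2 * (\<zeta> ^ (n + 1) * \<xi> ^ (n + 1))\<^sup>2" .
    have "grushin_coeff s b z * (box_bump_power_deriv n s r b z)\<^sup>2
        \<le> (2 powr s * r powr (2 * s)) * (8 * c\<^sup>2 / S\<^sup>2 * (\<zeta> ^ (n + 1) * \<xi> ^ (n + 1))\<^sup>2)"
      using 1 y \<open>b2 \<noteq> 0\<close> grushin_weight_le[OF s r, of "fst z"] False
      by (intro mult_mono) (auto simp: grushin_coeff_def)
    also have "\<dots> = 8 * c\<^sup>2 * 2 powr s / r\<^sup>2 * (\<xi> ^ (n + 1) * \<zeta> ^ (n + 1))\<^sup>2"
      using r by (simp add: S2 mult_ac)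
    finally show ?thesis by (simp only: bb c_def)
  qed
qed

section \<open>Absorbing the gradient term\<close>

lemma grushin_norm_ge:
  assumes s: "s \<ge> 0" and r: "r > 0"
    and z: "r\<^sup>2 \<le> fst z \<bullet> fst z \<or> (r powr (1 + s))\<^sup>2 \<le> snd z \<bullet> snd z"
  shows "r powr (2 * (s + 1)) \<le> grushin_norm s z powr (2 * (s + 1))"
proof -
  have "r powr (2 * (s + 1)) \<le> norm (fst z) powr (2 * (s + 1)) + (norm (snd z))\<^sup>2"
    using z
  proof
    assume "r\<^sup>2 \<le> fst z \<bullet> fst z"
    then have "r \<le> norm (fst z)" using r power2_le_imp_le[of r "norm (fst z)"] by (simp add: dot_square_norm)
    then have "r powr (2 * (s + 1)) \<le> norm (fst z) powr (2 * (s + 1))"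
      using r s by (intro powr_mono2) auto
    then show ?thesis by (simp add: add_increasing2)
  next
    assume "(r powr (1 + s))\<^sup>2 \<le> snd z \<bullet> snd z"
    then show ?thesis by (simp add: powr_one_plus_sq dot_square_norm add_increasing)
  qed
  also have "\<dots> = grushin_norm s z powr (2 * (s + 1))"
    using s by (simp add: grushin_norm_def powr_powr)
  finally show ?thesis .
qed

text \<open>
  This replaces Young's inequality: either the first term on the right dominates, or \<open>u^(-p-1)\<close>, hence
  also \<open>u^(-2a)\<close>, is bounded by a power of \<open>r\<close>.
\<close>

lemma absorb_gradient_term:
  fixes a p \<alpha> \<epsilon> K C r u \<psi> R :: real
  assumes a: "a > 0" and p: "p > 1" and "\<epsilon> > 0" "K > 0" "C > 0" "r > 0" "u > 0"
    and \<psi>: "0 \<le> \<psi>" "\<psi> \<le> 1" and n: "2 * a / (p + 1) \<le> real (n + 1)" and R: "C * r powr \<alpha> \<le> R"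
  shows "u powr (- 2 * a) * (K / r\<^sup>2 * \<psi> ^ (2 * (n + 1)))
    \<le> \<epsilon> * (\<psi> ^ (2 * (n + 2)) * u powr (- 2 * a) * (R * u powr (- p - 1)))
      + K * (K / (\<epsilon> * C)) powr (2 * a / (p + 1)) * r powr (- (2 + 2 * a * (2 + \<alpha>) / (p + 1)))"
proof (cases "\<psi> = 0 \<or> K / r\<^sup>2 \<le> \<epsilon> * \<psi>\<^sup>2 * R * u powr (- p - 1)")
  case True
  have "u powr (- 2 * a) * (K / r\<^sup>2 * \<psi> ^ (2 * (n + 1)))
    \<le> \<epsilon> * (\<psi> ^ (2 * (n + 2)) * u powr (- 2 * a) * (R * u powr (- p - 1)))"
  proof (cases "\<psi> = 0")
    case False
    then have "u powr (- 2 * a) * \<psi> ^ (2 * (n + 1)) * (K / r\<^sup>2)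
        \<le> u powr (- 2 * a) * \<psi> ^ (2 * (n + 1)) * (\<epsilon> * \<psi>\<^sup>2 * R * u powr (- p - 1))"
      using True \<psi> by (intro mult_left_mono) auto
    then show ?thesis by (simp add: power2_eq_square mult_ac)
  qed auto
  moreover have "0 \<le> K * (K / (\<epsilon> * C)) powr (2 * a / (p + 1)) * r powr (- (2 + 2 * a * (2 + \<alpha>) / (p + 1)))"
    using \<open>K > 0\<close> by simp
  ultimately show ?thesis by linarith
next
  case False
  \<comment> \<open>Raising a bound on u^(-p-1) to the power \<theta> turns it into a bound on
    u^(-2a).\<close>
  define \<theta> where "\<theta> = 2 * a / (p + 1)"
  have \<theta>: "\<theta> > 0" "\<theta> \<le> real (n + 1)" using a p n by (auto simp: \<theta>_def)
  have "\<psi> > 0" using False \<psi> by auto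
  have R0: "R \<ge> 0" using R \<open>C > 0\<close> by (meson mult_nonneg_nonneg less_imp_le powr_ge_zero order_trans)
  have "\<epsilon> * \<psi>\<^sup>2 * (C * r powr \<alpha>) * u powr (- p - 1) \<le> \<epsilon> * \<psi>\<^sup>2 * R * u powr (- p - 1)"
    using R \<open>\<epsilon> > 0\<close> by (intro mult_right_mono mult_left_mono) auto
  also have "\<dots> \<le> K / r\<^sup>2" using False by simp
  finally have "u powr (- p - 1) \<le> K / r\<^sup>2 / (\<epsilon> * \<psi>\<^sup>2 * (C * r powr \<alpha>))"
    using \<open>\<psi> > 0\<close> \<open>\<epsilon> > 0\<close> \<open>C > 0\<close> \<open>r > 0\<close> by (subst pos_le_divide_eq) (auto simp: mult_ac)
  also have "\<dots> = (K / (\<epsilon> * C)) * r powr (- (2 + \<alpha>)) * \<psi> powr (-2)"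
  proof -
    have "r powr (- (2 + \<alpha>)) = 1 / (r\<^sup>2 * r powr \<alpha>)"
      using \<open>r > 0\<close> by (simp only: powr_minus_divide powr_add) simp
    moreover have "\<psi> powr (-2) = 1 / \<psi>\<^sup>2"
      using \<open>\<psi> > 0\<close> by (simp add: powr_minus_divide)
    ultimately show ?thesis by simp
  qed
  finally have "(u powr (- p - 1)) powr \<theta> \<le> ((K / (\<epsilon> * C)) * r powr (- (2 + \<alpha>)) * \<psi> powr (-2)) powr \<theta>"
    using \<theta> by (intro powr_mono2) auto
  moreover have "(- p - 1) * \<theta> = - 2 * a" using p by (simp add: \<theta>_def divide_simps) (simp add: algebra_simps)
  ultimately have 1: "u powr (- 2 * a) \<le> (K / (\<epsilon> * C)) powr \<theta> * r powr (- ((2 + \<alpha>) * \<theta>)) * \<psi> powr (-2 * \<theta>)"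
    by (simp only: powr_powr powr_mult mult_minus_left)
  \<comment> \<open>The negative power of the cutoff produced by dividing by \<psi>^2 is compensated
    by the surviving power \<open>2 * (n + 1)\<close>; this is the reason for requiring n + 1 to be
    at least \<theta>.\<close>
  have 2: "\<psi> powr (-2 * \<theta>) * \<psi> ^ (2 * (n + 1)) \<le> 1"
  proof -
    have "\<psi> powr (-2 * \<theta>) * \<psi> ^ (2 * (n + 1)) = \<psi> powr (-2 * \<theta> + real (2 * (n + 1)))"
      using \<open>\<psi> > 0\<close> by (subst powr_add) (simp only: powr_realpow)
    also have "\<dots> \<le> 1" using \<psi> \<theta> by (intro powr_le1) auto
    finally show ?thesis .
  qed
  have "u powr (- 2 * a) * (K / r\<^sup>2 * \<psi> ^ (2 * (n + 1)))
      \<le> (K / (\<epsilon> * C)) powr \<theta> * r powr (- ((2 + \<alpha>) * \<theta>)) * \<psi> powr (-2 * \<theta>) * (K / r\<^sup>2 * \<psi> ^ (2 * (n + 1)))"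
    using 1 \<open>K > 0\<close> \<psi> by (intro mult_right_mono) auto
  also have "\<dots> = (K / (\<epsilon> * C)) powr \<theta> * r powr (- ((2 + \<alpha>) * \<theta>)) * (K / r\<^sup>2)
      * (\<psi> powr (-2 * \<theta>) * \<psi> ^ (2 * (n + 1)))" by simp
  also have "\<dots> \<le> (K / (\<epsilon> * C)) powr \<theta> * r powr (- ((2 + \<alpha>) * \<theta>)) * (K / r\<^sup>2) * 1"
    using 2 \<open>K > 0\<close> by (intro mult_left_mono) auto
  also have "\<dots> = K * (K / (\<epsilon> * C)) powr \<theta> * r powr (- (2 + (2 + \<alpha>) * \<theta>))"
  proof -
    have "r powr (- (2 + (2 + \<alpha>) * \<theta>)) = r powr (- ((2 + \<alpha>) * \<theta>)) * r powr (- 2)"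
      by (simp add: algebra_simps flip: powr_add)
    moreover have "r powr (- 2) = 1 / r\<^sup>2"
      using \<open>r > 0\<close> by (simp add: powr_minus_divide)
    ultimately show ?thesis by simp
  qed
  also have "(2 + \<alpha>) * \<theta> = 2 * a * (2 + \<alpha>) / (p + 1)" by (simp add: \<theta>_def)
  finally have "u powr (- 2 * a) * (K / r\<^sup>2 * \<psi> ^ (2 * (n + 1)))
      \<le> K * (K / (\<epsilon> * C)) powr (2 * a / (p + 1)) * r powr (- (2 + 2 * a * (2 + \<alpha>) / (p + 1)))"
    by (simp add: \<theta>_def)
  moreover have "0 \<le> \<epsilon> * (\<psi> ^ (2 * (n + 2)) * u powr (- 2 * a) * (R * u powr (- p - 1)))"
    using \<open>\<epsilon> > 0\<close> R0 \<psi> by simp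
  ultimately show ?thesis by linarith
qed

section \<open>The energy inequality\<close>

lemma DERIV_energy_field:
  fixes H U Ub W Wb :: "real \<Rightarrow> real"
  assumes H: "(H has_real_derivative h') (at t)"
    and U: "(U has_real_derivative Ub t) (at t)" "(Ub has_real_derivative ub') (at t)" "U t > 0"
    and W: "(W has_real_derivative Wb t) (at t)" "(Wb has_real_derivative wb') (at t)" "W t > 0"
  shows "((\<lambda>t. (H t)\<^sup>2 * U t powr (- 2 * a) * (Wb t / W t + \<mu> * (Ub t / U t))) has_real_derivative
     (2 * H t * h' * U t powr (- 2 * a) * (Wb t / W t + \<mu> * (Ub t / U t))
      - 2 * a * (H t)\<^sup>2 * U t powr (- 2 * a) * (Ub t / U t) * (Wb t / W t + \<mu> * (Ub t / U t))
      + (H t)\<^sup>2 * U t powr (- 2 * a)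
        * (wb' / W t - (Wb t / W t)\<^sup>2 + \<mu> * (ub' / U t - (Ub t / U t)\<^sup>2)))) (at t)"
proof -
  have P: "((\<lambda>t. U t powr (- 2 * a)) has_real_derivative - 2 * a * U t powr (- 2 * a) * (Ub t / U t)) (at t)"
    using DERIV_chain2[OF has_real_derivative_powr[OF U(3), of "- 2 * a"] U(1)] U(3)
    by (simp add: powr_diff)
  have Q: "((\<lambda>t. Wb t / W t + \<mu> * (Ub t / U t)) has_real_derivative
      wb' / W t - (Wb t / W t)\<^sup>2 + \<mu> * (ub' / U t - (Ub t / U t)\<^sup>2)) (at t)"
    using U(3) W(3)
    by (auto intro!: derivative_eq_intros U W simp: power2_eq_square diff_divide_distrib right_diff_distrib mult_ac)
  have R: "((\<lambda>t. (H t)\<^sup>2) has_real_derivative 2 * H t * h') (at t)"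
    by (auto intro!: derivative_eq_intros H)
  show ?thesis
    by (rule DERIV_cong[OF DERIV_mult[OF DERIV_mult[OF R P] Q]]) (simp add: algebra_simps)
qed

text \<open>\<open>D\<close> is the weighted divergence of the energy field; each coordinate term
  integrates to 0 on its own. In the pointwise bound the two equations turn the second-order part
  into -(p - \<mu>)V, and \<open>quadratic_form_bound\<close> controls the rest. Providing
  \<open>D\<close> with a pointwise bound allows the right-hand side to be estimated before anything
  is integrated.\<close>

lemma stable_energy_inequality:
  fixes u w \<eta> V :: "(real^'n) \<times> (real^'m) \<Rightarrow> real"
  assumes s: "s \<ge> 0"
    and u: "Ck 2 u" "\<And>z. u z > 0" "\<And>z. grushin s u z = V z * u z"
    and w: "Ck 2 w" "\<And>z. w z > 0" "\<And>z. grushin s w z = - p * V z * w z"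
    and \<eta>: "continuous_on UNIV \<eta>" "\<And>b. b \<in> Basis \<Longrightarrow> continuous_on UNIV (\<eta>' b)"
      "\<And>b z. b \<in> Basis \<Longrightarrow> ((\<lambda>t. \<eta> (z + t *\<^sub>R b)) has_real_derivative \<eta>' b z) (at 0)"
      "\<And>z. norm z > B \<Longrightarrow> \<eta> z = 0" "\<And>b z. norm z > B \<Longrightarrow> \<eta>' b z = 0"
    and a: "a\<^sup>2 < \<mu> * (1 + 2 * a)"
  obtains D where "(D has_integral 0) UNIV"
    "\<And>z. D z \<le> - (p - \<mu>) * ((\<eta> z)\<^sup>2 * u z powr (- 2 * a) * V z)
       + (1 + (\<mu> - a)\<^sup>2 / (\<mu> * (1 + 2 * a) - a\<^sup>2))
          * (u z powr (- 2 * a) * (\<Sum>b\<in>Basis. grushin_coeff s b z * (\<eta>' b z)\<^sup>2))"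
proof -
  define K where "K = 1 + (\<mu> - a)\<^sup>2 / (\<mu> * (1 + 2 * a) - a\<^sup>2)"
  define F where "F b z = partial_deriv b w z / w z" for b z
  define G where "G b z = partial_deriv b u z / u z" for b z
  \<comment> \<open>\<open>d b\<close> is the derivative along \<open>b\<close> of the field
    component \<open>P b\<close>, as computed in \<open>DERIV_energy_field\<close>.\<close>
  define d where "d b z = 2 * \<eta> z * \<eta>' b z * u z powr (- 2 * a) * (F b z + \<mu> * G b z)
      - 2 * a * (\<eta> z)\<^sup>2 * u z powr (- 2 * a) * G b z * (F b z + \<mu> * G b z)
      + (\<eta> z)\<^sup>2 * u z powr (- 2 * a)
        * (partial_deriv b (partial_deriv b w) z / w z - (F b z)\<^sup>2
          + \<mu> * (partial_deriv b (partial_deriv b u) z / u z - (G b z)\<^sup>2))" for b z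
  define P where "P b z = (\<eta> z)\<^sup>2 * u z powr (- 2 * a) * (F b z + \<mu> * G b z)" for b z
  define D where "D z = (\<Sum>b\<in>Basis. grushin_coeff s b z * d b z)" for z
  have u0: "u z \<noteq> 0" and w0: "w z \<noteq> 0" for z using u(2)[of z] w(2)[of z] by auto
  have cu: "continuous_on UNIV u" and cw: "continuous_on UNIV w"
    using Ck_2_D(3)[OF u(1)] Ck_2_D(3)[OF w(1)] nonempty_Basis by blast+
  have "((\<lambda>z. grushin_coeff s b z * d b z) has_integral 0) UNIV" if b: "b \<in> Basis" for b
  proof (rule has_integral_directional_derivative_0)
    note cont = cu cw \<eta>(1) \<eta>(2)[OF b] Ck_2_D(4,5)[OF u(1) b] Ck_2_D(4,5)[OF w(1) b]
      continuous_on_grushin_coeff[OF s]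
    show "continuous_on UNIV (\<lambda>z. grushin_coeff s b z * P b z)"
      unfolding P_def F_def G_def by (intro continuous_intros cont) (auto simp: u0 w0)
    show "continuous_on UNIV (\<lambda>z. grushin_coeff s b z * d b z)"
      unfolding d_def F_def G_def by (intro continuous_intros cont) (auto simp: u0 w0)
    fix z :: "(real^'n) \<times> (real^'m)"
    have "((\<lambda>t. P b (z + t *\<^sub>R b)) has_real_derivative d b z) (at 0)"
      using DERIV_energy_field[where H = "\<lambda>t. \<eta> (z + t *\<^sub>R b)" and U = "\<lambda>t. u (z + t *\<^sub>R b)"
          and Ub = "\<lambda>t. partial_deriv b u (z + t *\<^sub>R b)" and W = "\<lambda>t. w (z + t *\<^sub>R b)"
          and Wb = "\<lambda>t. partial_deriv b w (z + t *\<^sub>R b)" and t = 0 and a = a and \<mu> = \<mu>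
          and h' = "\<eta>' b z" and ub' = "partial_deriv b (partial_deriv b u) z"
          and wb' = "partial_deriv b (partial_deriv b w) z"]
        \<eta>(3)[OF b] u(2) w(2) Ck_2_D(1,2)[OF u(1) b] Ck_2_D(1,2)[OF w(1) b]
      by (simp add: has_real_derivative_partial_deriv P_def d_def F_def G_def)
    from DERIV_cmult[OF this, of "grushin_coeff s b z"]
    show "((\<lambda>t. grushin_coeff s b (z + t *\<^sub>R b) * P b (z + t *\<^sub>R b)) has_real_derivative
        grushin_coeff s b z * d b z) (at 0)"
      by (simp add: grushin_coeff_shift[OF b])
  next
    fix z :: "(real^'n) \<times> (real^'m)"
    assume "norm z > B"
    then show "grushin_coeff s b z * P b z = 0" "grushin_coeff s b z * d b z = 0"
      by (simp_all add: P_def d_def \<eta>(4,5))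
  qed
  then have "(D has_integral (\<Sum>b\<in>(Basis :: ((real^'n) \<times> (real^'m)) set). 0)) UNIV"
    unfolding D_def by (intro has_integral_sum) auto
  then have int: "(D has_integral 0) UNIV" by simp
  have "D z \<le> - (p - \<mu>) * ((\<eta> z)\<^sup>2 * u z powr (- 2 * a) * V z)
       + K * (u z powr (- 2 * a) * (\<Sum>b\<in>Basis. grushin_coeff s b z * (\<eta>' b z)\<^sup>2))" for z
  proof -
    define e where "e = u z powr (- 2 * a)"
    have d_le: "d b z \<le> (\<eta> z)\<^sup>2 * e * (partial_deriv b (partial_deriv b w) z / w z
          + \<mu> * (partial_deriv b (partial_deriv b u) z / u z)) + K * e * (\<eta>' b z)\<^sup>2" for b
    proof -
      \<comment> \<open>The pure second derivatives, which add up to Grushin operators, are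
        separated from the quadratic form with N = \<eta>', X = \<eta>F, Y = \<eta>G.\<close>
      have "d b z = (\<eta> z)\<^sup>2 * e * (partial_deriv b (partial_deriv b w) z / w z
          + \<mu> * (partial_deriv b (partial_deriv b u) z / u z))
          + e * (2 * \<eta>' b z * (\<eta> z * F b z + \<mu> * (\<eta> z * G b z)) - 2 * a * (\<eta> z * F b z) * (\<eta> z * G b z)
              - \<mu> * (1 + 2 * a) * (\<eta> z * G b z)\<^sup>2 - (\<eta> z * F b z)\<^sup>2)"
        by (simp add: d_def e_def power2_eq_square algebra_simps)
      also have "\<dots> \<le> (\<eta> z)\<^sup>2 * e * (partial_deriv b (partial_deriv b w) z / w z
          + \<mu> * (partial_deriv b (partial_deriv b u) z / u z)) + e * (K * (\<eta>' b z)\<^sup>2)"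
        unfolding K_def by (intro add_left_mono mult_left_mono quadratic_form_bound a) (simp add: e_def)
      finally show ?thesis by (simp add: mult_ac)
    qed
    have "D z \<le> (\<Sum>b\<in>Basis. grushin_coeff s b z * ((\<eta> z)\<^sup>2 * e * (partial_deriv b (partial_deriv b w) z / w z
          + \<mu> * (partial_deriv b (partial_deriv b u) z / u z)) + K * e * (\<eta>' b z)\<^sup>2))"
      unfolding D_def by (intro sum_mono mult_left_mono d_le grushin_coeff_nonneg)
    also have "\<dots> = (\<eta> z)\<^sup>2 * e * (grushin s w z / w z + \<mu> * (grushin s u z / u z))
        + K * e * (\<Sum>b\<in>Basis. grushin_coeff s b z * (\<eta>' b z)\<^sup>2)"
      unfolding grushin_eq_sum
      by (simp add: sum_distrib_left sum_divide_distrib sum.distrib algebra_simps)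
    also have "grushin s w z / w z = - p * V z" using w0[of z] by (simp add: w(3))
    also have "grushin s u z / u z = V z" using u0[of z] by (simp add: u(3))
    finally show ?thesis by (simp add: e_def algebra_simps)
  qed
  from that[OF int this[unfolded K_def]] show thesis .
qed

section \<open>Additivity of the operator, for the sum of the two stability functions\<close>

lemma partial_deriv_add:
  assumes "f differentiable_on UNIV" "g differentiable_on UNIV"
  shows "partial_deriv b (\<lambda>z. f z + g z) = (\<lambda>z. partial_deriv b f z + partial_deriv b g z)"
proof
  fix z
  have "(f has_derivative frechet_derivative f (at z)) (at z)" "(g has_derivative frechet_derivative g (at z)) (at z)"
    using assms by (simp_all add: differentiable_on_def flip: frechet_derivative_works)
  from frechet_derivative_at[OF has_derivative_add[OF this], symmetric]
  show "partial_deriv b (\<lambda>z. f z + g z) z = partial_deriv b f z + partial_deriv b g z"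
    by (simp add: partial_deriv_def)
qed

lemma Ck_add: "Ck k f \<Longrightarrow> Ck k g \<Longrightarrow> Ck k (\<lambda>z. f z + g z)"
  by (induction k arbitrary: f g) (auto simp: partial_deriv_add intro: continuous_on_add)

lemma grushin_add:
  assumes "Ck 2 f" "Ck 2 g"
  shows "grushin s (\<lambda>z. f z + g z) z = grushin s f z + grushin s g z"
proof -
  have "partial_deriv b (partial_deriv b (\<lambda>z. f z + g z)) z
      = partial_deriv b (partial_deriv b f) z + partial_deriv b (partial_deriv b g) z"
    if "b \<in> Basis" for b
    using Ck_2_D(1,2)[OF assms(1) that] Ck_2_D(1,2)[OF assms(2) that] by (simp add: partial_deriv_add)
  then show ?thesis by (simp add: grushin_eq_sum algebra_simps sum.distrib)
qed

section \<open>The volume of the cutoff region and the estimate at scale r\<close>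

text \<open>A coordinate box containing the support of \<open>box_bump\<close>, chosen for its
  explicit volume. The cutoff already vanishes from |x| = sqrt(2) r on, and likewise in y; the
  factor 2 avoids the root.\<close>

definition support_box :: "real \<Rightarrow> real \<Rightarrow> ((real^'n) \<times> (real^'m)) set" where
  "support_box s r = cbox ((\<chi> i. - (2 * r)), (\<chi> j. - (2 * r powr (1 + s)))) ((\<chi> i. 2 * r), (\<chi> j. 2 * r powr (1 + s)))"

lemma inner_self_gt_outside_cbox:
  fixes x :: "real^'n"
  assumes "d > 0" "x \<notin> cbox (\<chi> i. - (2 * d)) (\<chi> i. 2 * d)"
  shows "2 * d\<^sup>2 \<le> x \<bullet> x"
proof -
  obtain i where "\<not> (- (2 * d) \<le> x $ i \<and> x $ i \<le> 2 * d)"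
    using assms(2) by (auto simp: mem_box_cart)
  then have "\<bar>x $ i\<bar> > 2 * d" by linarith
  then have "(2 * d)\<^sup>2 \<le> \<bar>x $ i\<bar>\<^sup>2" using assms(1) by (intro power_mono) auto
  also have "\<dots> \<le> x \<bullet> x"
    using inner_Basis_sq_le[of "axis i 1" x] by (simp add: inner_axis)
  finally have "4 * d\<^sup>2 \<le> x \<bullet> x" by (simp add: power_mult_distrib)
  then show ?thesis using zero_le_power2[of d] by linarith
qed

lemma outside_support_box:
  assumes "r > 0" "z \<notin> support_box s r"
  shows "2 * r\<^sup>2 \<le> fst z \<bullet> fst z \<or> 2 * (r powr (1 + s))\<^sup>2 \<le> snd z \<bullet> snd z"
  using assms inner_self_gt_outside_cbox[of r "fst z"] inner_self_gt_outside_cbox[of "r powr (1 + s)" "snd z"]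
  by (cases z) (auto simp: support_box_def cbox_Pair_eq)

text \<open>The side lengths 4r and 4r^(1+s) multiply to a constant times r^N1 r^((1+s)N2); this is
  where the homogeneous dimension enters.\<close>

lemma content_support_box:
  assumes "r > 0"
  shows "measure lborel (support_box s r :: ((real^'n) \<times> (real^'m)) set)
    = 4 ^ (CARD('n) + CARD('m)) * r powr homogeneous_dim CARD('n) CARD('m) s"
proof -
  have cart: "measure lborel (cbox (\<chi> i. - (2 * d)) (\<chi> i. 2 * d) :: (real^'k) set) = (4 * d) ^ CARD('k)"
    if "d > 0" for d :: real
    using that by (subst content_cbox_cart) (auto simp: interval_ne_empty_cart)
  have "measure lborel (support_box s r :: ((real^'n) \<times> (real^'m)) set)
      = (4 * r) ^ CARD('n) * (4 * r powr (1 + s)) ^ CARD('m)"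
    using assms by (simp add: support_box_def content_Pair cart)
  also have "\<dots> = 4 ^ (CARD('n) + CARD('m)) * (r powr real CARD('n) * (r powr (1 + s)) powr real CARD('m))"
    using assms by (simp add: power_mult_distrib power_add powr_realpow)
  finally show ?thesis
    by (simp only: homogeneous_dim_def powr_powr powr_add[of r "real CARD('n)"])
qed

text \<open>For each r the energy inequality leads to a pointwise comparison of \<open>D\<close>
  plus a multiple of the indicator of the unit ball with T r^(-\<kappa>) times the indicator of the
  box. Integrating removes \<open>D\<close> and leaves a positive constant below a multiple of
  r^(N_s - \<kappa>), with constants independent of r.\<close>

lemma cutoff_estimate:
  fixes \<rho> u w :: "(real^'n) \<times> (real^'m) \<Rightarrow> real"
  assumes s: "s \<ge> 0" and p: "p > 1" and \<alpha>: "\<alpha> \<ge> 0" and C: "C > 0"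
    and \<rho>: "\<And>z. \<rho> z \<ge> C * (1 + grushin_norm s z powr (2 * (s + 1))) powr (\<alpha> / (2 * (s + 1)))"
    and u: "Ck 2 u" "\<And>z. u z > 0" "\<And>z. grushin s u z = \<rho> z * u z powr (-p)"
    and w: "Ck 2 w" "\<And>z. w z > 0" "\<And>z. - grushin s w z = p * \<rho> z * u z powr (-p - 1) * w z"
    and M: "\<And>z. u z \<le> M"
    and a: "a > 0" "\<mu> < p" "a\<^sup>2 < \<mu> * (1 + 2 * a)"
  obtains c L where "c > 0"
    "\<And>r. r \<ge> 1 \<Longrightarrow> c \<le> L * r powr (homogeneous_dim CARD('n) CARD('m) s - (2 + 2 * a * (2 + \<alpha>) / (p + 1)))"
proof -
  define V where "V z = \<rho> z * u z powr (- p - 1)" for z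
  define \<kappa> where "\<kappa> = 2 + 2 * a * (2 + \<alpha>) / (p + 1)"
  \<comment> \<open>Half of the gap p - \<mu> absorbs the gradient term; the other half remains for
    the lower bound on the unit ball.\<close>
  define \<epsilon> where "\<epsilon> = (p - \<mu>) / 2"
  obtain n :: nat where "2 * a / (p + 1) \<le> real n" using real_arch_simple by blast
  then have n: "2 * a / (p + 1) \<le> real (n + 1)" by simp
  define K1 where "K1 = 1 + (\<mu> - a)\<^sup>2 / (\<mu> * (1 + 2 * a) - a\<^sup>2)"
  define K where "K = K1 * (real DIM((real^'n) \<times> (real^'m)) * (8 * (2 * real (n + 2))\<^sup>2 * 2 powr s))"
  define T where "T = K * (K / (\<epsilon> * C)) powr (2 * a / (p + 1))"
  \<comment> \<open>On the unit ball the cutoff is 1, \<rho> is at least C and u is at most M; as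
    the exponent of u is negative, \<open>c\<close> bounds \<epsilon> times the energy density from
    below.\<close>
  define c where "c = \<epsilon> * (C * M powr (- 2 * a + (- p - 1)))"
  have "K1 > 0" using a by (simp add: K1_def add_pos_nonneg)
  then have "K > 0" unfolding K_def by (intro mult_pos_pos) (auto simp: add_pos_pos)
  have "\<epsilon> > 0" using a by (simp add: \<epsilon>_def)
  have "T \<ge> 0" using \<open>K > 0\<close> by (simp add: T_def)
  have "M > 0" using u(2)[of 0] M[of 0] by linarith
  have \<rho>_ge: "\<rho> z \<ge> C" for z
  proof -
    have "1 \<le> (1 + grushin_norm s z powr (2 * (s + 1))) powr (\<alpha> / (2 * (s + 1)))"
      using s \<alpha> by (intro ge_one_powr_ge_zero) auto
    then have "C * 1 \<le> C * (1 + grushin_norm s z powr (2 * (s + 1))) powr (\<alpha> / (2 * (s + 1)))"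
      using C by (intro mult_left_mono) auto
    then show ?thesis using \<rho>[of z] by linarith
  qed
  have V_nonneg: "V z \<ge> 0" for z
    using \<rho>_ge[of z] C by (simp add: V_def)
  have key: "c * measure lebesgue (cball (0::(real^'n) \<times> (real^'m)) 1)
      \<le> T * r powr (- \<kappa>) * measure lborel (support_box s r :: ((real^'n) \<times> (real^'m)) set)" if r: "r \<ge> 1" for r
  proof -
    define \<eta> where "\<eta> z = box_bump s r z ^ (n + 2)" for z :: "(real^'n) \<times> (real^'m)"
    have r0: "r > 0" using r by simp
    have "bounded (support_box s r :: ((real^'n) \<times> (real^'m)) set)" by (simp add: support_box_def bounded_cbox)
    then obtain B where B: "\<And>z. z \<in> (support_box s r :: ((real^'n) \<times> (real^'m)) set) \<Longrightarrow> norm z \<le> B"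
      by (auto simp: bounded_iff)
    have outside: "2 * r\<^sup>2 \<le> fst z \<bullet> fst z \<or> 2 * (r powr (1 + s))\<^sup>2 \<le> snd z \<bullet> snd z"
      if "norm z > B" for z :: "(real^'n) \<times> (real^'m)"
      using B[of z] that by (intro outside_support_box r0) auto
    obtain D where D: "(D has_integral 0) UNIV"
      and D_le: "\<And>z. D z \<le> - (p - \<mu>) * ((\<eta> z)\<^sup>2 * u z powr (- 2 * a) * V z)
       + K1 * (u z powr (- 2 * a)
           * (\<Sum>b\<in>Basis. grushin_coeff s b z * (box_bump_power_deriv n s r b z)\<^sup>2))"
    proof (rule stable_energy_inequality[OF s u(1,2) _ w(1,2) _ _ _ _ _ _ a(3),
          where V = V and p = p and \<eta> = \<eta> and \<eta>' = "box_bump_power_deriv n s r" and B = B])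
      show "grushin s u z = V z * u z" for z
        using u(2)[of z] by (simp add: u(3) V_def powr_diff)
      show "grushin s w z = - p * V z * w z" for z
        using w(3)[of z] by (simp add: V_def)
      show "continuous_on UNIV \<eta>"
        unfolding \<eta>_def by (intro continuous_intros r0)
      show "continuous_on UNIV (box_bump_power_deriv n s r b)" for b :: "(real^'n) \<times> (real^'m)"
        by (intro continuous_intros r0)
      show "((\<lambda>t. \<eta> (z + t *\<^sub>R b)) has_real_derivative box_bump_power_deriv n s r b z) (at 0)" for b z
        unfolding \<eta>_def by (rule DERIV_box_bump_power)
      show "\<eta> z = 0" if "norm z > B" for z
        using box_bump_eq_0[OF r0 outside[OF that]] by (simp add: \<eta>_def)
      show "box_bump_power_deriv n s r b z = 0" if "norm z > B" for b z :: "(real^'n) \<times> (real^'m)"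
        using box_bump_power_deriv_eq_0[OF r0 outside[OF that]] by simp
    qed (auto simp: K1_def)
    define X where "X z = (\<eta> z)\<^sup>2 * u z powr (- 2 * a) * V z" for z
    have X_nonneg: "X z \<ge> 0" for z by (simp add: X_def V_nonneg)
    have T_nonneg: "0 \<le> T * r powr (- \<kappa>) * indicator (support_box s r) z" for z :: "(real^'n) \<times> (real^'m)"
      using \<open>T \<ge> 0\<close> by simp
    \<comment> \<open>Where the cutoff has zero gradient, the energy inequality suffices. Elsewhere
      the point lies in the box and \<rho> is at least C r^\<alpha>, so
      \<open>absorb_gradient_term\<close> applies.\<close>
    have "D z \<le> - \<epsilon> * X z + T * r powr (- \<kappa>) * indicator (support_box s r) z" for z
    proof (cases "\<forall>b\<in>Basis. box_bump_power_deriv n s r b z = 0")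
      case True
      then have "D z \<le> - (p - \<mu>) * X z" using D_le[of z] by (simp add: X_def)
      also have "\<dots> = - \<epsilon> * X z - \<epsilon> * X z" by (simp add: \<epsilon>_def field_simps)
      finally have "D z \<le> - \<epsilon> * X z - \<epsilon> * X z" .
      moreover have "0 \<le> \<epsilon> * X z" using X_nonneg[of z] \<open>\<epsilon> > 0\<close> by simp
      ultimately show ?thesis using T_nonneg[of z] by linarith
    next
      case False
      then obtain b where b: "b \<in> Basis" "box_bump_power_deriv n s r b z \<noteq> 0" by blast
      have in_box: "z \<in> support_box s r"
        using b(2) box_bump_power_deriv_eq_0[OF r0 outside_support_box[OF r0]] by blast
      have "C * r powr \<alpha> \<le> \<rho> z"
      proof -
        have "(r powr (2 * (s + 1))) powr (\<alpha> / (2 * (s + 1)))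
            \<le> (1 + grushin_norm s z powr (2 * (s + 1))) powr (\<alpha> / (2 * (s + 1)))"
          using grushin_norm_ge[OF s r0 box_bump_power_deriv_neq_0D[OF b(2) r0]] s \<alpha>
          by (intro powr_mono2) auto
        moreover have "(r powr (2 * (s + 1))) powr (\<alpha> / (2 * (s + 1))) = r powr \<alpha>"
          using s by (simp add: powr_powr)
        ultimately have "C * r powr \<alpha> \<le> C * (1 + grushin_norm s z powr (2 * (s + 1))) powr (\<alpha> / (2 * (s + 1)))"
          using C by simp
        then show ?thesis using \<rho>[of z] by linarith
      qed
      note absorb = absorb_gradient_term[OF a(1) p \<open>\<epsilon> > 0\<close> \<open>K > 0\<close> C r0 u(2) box_bump_bounds n this,
          of z s r z]
      have "(\<Sum>b\<in>Basis. grushin_coeff s b z * (box_bump_power_deriv n s r b z)\<^sup>2)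
          \<le> (\<Sum>b\<in>(Basis :: ((real^'n) \<times> (real^'m)) set). 8 * (2 * real (n + 2))\<^sup>2 * 2 powr s / r\<^sup>2 * box_bump s r z ^ (2 * (n + 1)))"
        by (intro sum_mono box_bump_gradient_bound s r0)
      also have "\<dots> = real DIM((real^'n) \<times> (real^'m)) * (8 * (2 * real (n + 2))\<^sup>2 * 2 powr s / r\<^sup>2 * box_bump s r z ^ (2 * (n + 1)))"
        by simp
      finally have "K1 * (u z powr (- 2 * a)
           * (\<Sum>b\<in>Basis. grushin_coeff s b z * (box_bump_power_deriv n s r b z)\<^sup>2))
         \<le> K1 * (u z powr (- 2 * a)
           * (real DIM((real^'n) \<times> (real^'m)) * (8 * (2 * real (n + 2))\<^sup>2 * 2 powr s / r\<^sup>2 * box_bump s r z ^ (2 * (n + 1)))))"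
        using \<open>K1 > 0\<close> by (intro mult_left_mono) auto
      also have "\<dots> = u z powr (- 2 * a) * (K / r\<^sup>2 * box_bump s r z ^ (2 * (n + 1)))"
        by (simp add: K_def)
      also have "\<dots> \<le> \<epsilon> * (box_bump s r z ^ (2 * (n + 2)) * u z powr (- 2 * a) * (\<rho> z * u z powr (- p - 1)))
          + T * r powr (- \<kappa>)"
        using absorb by (simp only: T_def \<kappa>_def)
      also have "box_bump s r z ^ (2 * (n + 2)) * u z powr (- 2 * a) * (\<rho> z * u z powr (- p - 1)) = X z"
        by (simp only: X_def V_def \<eta>_def mult.commute[of 2] power_mult)
      finally have "D z \<le> - (p - \<mu>) * X z + (\<epsilon> * X z + T * r powr (- \<kappa>))"
        using D_le[of z] by (simp add: X_def)
      also have "\<dots> = - \<epsilon> * X z + T * r powr (- \<kappa>)" by (simp add: \<epsilon>_def field_simps)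
      finally show ?thesis using in_box by simp
    qed
    moreover have "c * indicator (cball 0 1) z \<le> \<epsilon> * X z" for z
    proof (cases "norm z \<le> 1")
      case True
      have "C * M powr (- 2 * a + (- p - 1)) \<le> \<rho> z * u z powr (- 2 * a + (- p - 1))"
        using \<rho>_ge[of z] C M[of z] u(2)[of z] a p by (intro mult_mono powr_mono2') auto
      also have "\<dots> = X z"
        using box_bump_eq_1[OF r s True]
        by (simp only: X_def V_def \<eta>_def powr_add[of "u z" "- 2 * a" "- p - 1"]) simp
      finally show ?thesis using True \<open>\<epsilon> > 0\<close> by (simp add: c_def)
    next
      case False
      then show ?thesis using X_nonneg[of z] \<open>\<epsilon> > 0\<close> by simp
    qed
    ultimately have le: "D z + c * indicator (cball 0 1) z
        \<le> T * r powr (- \<kappa>) * indicator (support_box s r) z" for z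
      by (smt (verit) mult_minus_left)
    have ball: "(indicator (cball (0::(real^'n) \<times> (real^'m)) 1) has_integral measure lebesgue (cball (0::(real^'n) \<times> (real^'m)) 1)) UNIV"
      using lmeasurable_iff_has_integral lmeasurable_cball by blast
    have box: "(indicator (support_box s r :: ((real^'n) \<times> (real^'m)) set) has_integral measure lborel (support_box s r :: ((real^'n) \<times> (real^'m)) set)) UNIV"
    proof -
      have "(indicator (support_box s r :: ((real^'n) \<times> (real^'m)) set) has_integral measure lebesgue (support_box s r :: ((real^'n) \<times> (real^'m)) set)) UNIV"
        using lmeasurable_iff_has_integral lmeasurable_cbox support_box_def by metis
      then show ?thesis by (simp add: support_box_def)
    qed
    have "0 + c * measure lebesgue (cball (0::(real^'n) \<times> (real^'m)) 1) \<le> T * r powr (- \<kappa>) * measure lborel (support_box s r :: ((real^'n) \<times> (real^'m)) set)"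
      using has_integral_le[OF has_integral_add[OF D has_integral_mult_right[OF ball, of c]]
          has_integral_mult_right[OF box, of "T * r powr (- \<kappa>)"]] le by simp
    then show ?thesis by simp
  qed
  show thesis
  proof (rule that[of "c * measure lebesgue (cball (0::(real^'n) \<times> (real^'m)) 1)" "T * 4 ^ (CARD('n) + CARD('m))"])
    have "measure lebesgue (cball (0::(real^'n) \<times> (real^'m)) 1) > 0"
      using content_cball_pos[of 1 "0::(real^'n) \<times> (real^'m)"] by simp
    then show "0 < c * measure lebesgue (cball (0::(real^'n) \<times> (real^'m)) 1)"
      using \<open>\<epsilon> > 0\<close> C \<open>M > 0\<close> by (simp add: c_def)
    fix r :: real assume r: "r \<ge> 1"
    have "measure lborel (support_box s r :: ((real^'n) \<times> (real^'m)) set)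
        = 4 ^ (CARD('n) + CARD('m)) * r powr homogeneous_dim CARD('n) CARD('m) s"
      using r by (intro content_support_box) simp
    then show "c * measure lebesgue (cball (0::(real^'n) \<times> (real^'m)) 1) \<le> T * 4 ^ (CARD('n) + CARD('m))
        * r powr (homogeneous_dim CARD('n) CARD('m) s - (2 + 2 * a * (2 + \<alpha>) / (p + 1)))"
      using key[OF r] powr_add[of r "homogeneous_dim CARD('n) CARD('m) s" "- \<kappa>"]
      unfolding \<kappa>_def[symmetric] by (simp add: mult_ac)
  qed
qed

section \<open>Conclusion by letting r tend to infinity\<close>

theorem corollary1p1:
  fixes s p \<alpha> C :: real and \<rho> :: "(real^'n) \<times> (real^'m) \<Rightarrow> real"
  assumes "s \<ge> 0" and "p > 1"
    and "continuous_on UNIV \<rho>" and "grushin_radial s \<rho>"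
    and "\<alpha> \<ge> 0" and "C > 0"
    and "\<And>z. \<rho> z \<ge> C * (1 + grushin_norm s z powr (2 * (s + 1))) powr (\<alpha> / (2 * (s + 1)))"
    and "homogeneous_dim CARD('n) CARD('m) s
           < 2 + 2 * (2 + \<alpha>) / (p + 1) * (p + sqrt (p\<^sup>2 + p))"
  shows "\<not> (\<exists>u. is_solution s p \<rho> u \<and> bounded (range u) \<and> stable_solution s p \<rho> u)"
proof
  assume "\<exists>u. is_solution s p \<rho> u \<and> bounded (range u) \<and> stable_solution s p \<rho> u"
  then obtain u \<phi> \<psi> where u: "Ck 2 u" "\<And>z. u z > 0" "\<And>z. grushin s u z = \<rho> z * u z powr (-p)"
    and bdd: "bounded (range u)"
    and smooth: "smooth \<phi>" "smooth \<psi>" and pos: "\<And>z. \<phi> z > 0" "\<And>z. \<psi> z > 0"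
    and eq: "\<And>z. - grushin s \<phi> z = p * \<rho> z * u z powr (-p - 1) * \<psi> z"
      "\<And>z. - grushin s \<psi> z = p * \<rho> z * u z powr (-p - 1) * \<phi> z"
    unfolding is_solution_def stable_solution_def by blast
  have Ck: "Ck 2 \<phi>" "Ck 2 \<psi>" using smooth unfolding smooth_def by blast+
  define w where "w z = \<phi> z + \<psi> z" for z
  have w: "Ck 2 w" "w z > 0" "- grushin s w z = p * \<rho> z * u z powr (-p - 1) * w z" for z
    unfolding w_def using Ck pos[of z] eq[of z]
    by (auto simp: grushin_add distrib_left intro: Ck_add)
  obtain M where "\<And>z. \<bar>u z\<bar> \<le> M" using bdd by (auto simp: bounded_iff)
  then have M: "u z \<le> M" for z using abs_le_D1 by blast
  obtain a \<mu> where a: "a > 0" "\<mu> < p" "a\<^sup>2 < \<mu> * (1 + 2 * a)"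
    "homogeneous_dim CARD('n) CARD('m) s < 2 + 2 * a * (2 + \<alpha>) / (p + 1)"
    using exponent_exists[OF assms(2,5,8)] by metis
  obtain c L where "c > 0" and L: "\<And>r. r \<ge> 1 \<Longrightarrow>
      c \<le> L * r powr (homogeneous_dim CARD('n) CARD('m) s - (2 + 2 * a * (2 + \<alpha>) / (p + 1)))"
    using cutoff_estimate[OF assms(1,2,5,6,7) u w M a(1-3)] by metis
  \<comment> \<open>By the choice of \<open>a\<close> the exponent is negative, so the upper bound
    for the fixed positive \<open>c\<close> tends to 0.\<close>
  have "((\<lambda>r. L * r powr (homogeneous_dim CARD('n) CARD('m) s - (2 + 2 * a * (2 + \<alpha>) / (p + 1)))) \<longlongrightarrow> L * 0) at_top"
    using a(4) by (intro tendsto_mult tendsto_const tendsto_neg_powr filterlim_ident) auto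
  then have "c \<le> L * 0"
    by (rule tendsto_lowerbound) (auto intro: eventually_mono[OF eventually_ge_at_top[of 1]] L)
  with \<open>c > 0\<close> show False by simp
qed

end
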